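(* Rule based layers generalize fully connected and convolutional feed-forward layers; in particular, both are static rule based layers. Precisely, let $\sigma$ be an arbitrary activation function. (1) For all $n,m\in\mathbb{N}$ there is a static rule $\mathbf{R}$ (with input dimension $n$ and output dimension $m$) such that the rule based layer $f(-,\Theta,\mathbf{R})$ with activation $\sigma$ is a fully connected layer: there is a bijection between the entries of a weight matrix $W\in\mathbb{R}^{m\times n}$ and bias vector $b\in\mathbb{R}^m$ and the learnable parameters in $\Theta$ under which $f(x,\Theta,\mathbf{R})=\sigma(Wx+b)$ for all $x\in\mathbb{R}^n$ and all values of the parameters. The same holds for fully connected layers without bias vector. (2) For every convolutional layer architecture with activation $\sigma$ there is a static rule $\mathbf{R}$ such that the rule based layer $f(-,\Theta,\mathbf{R})$ with activation $\sigma$ is that convolutional layer: there is a bijection between the kernel weights and bias parameters of the convolutional layer and the learnable parameters in $\Theta$ under which, after flattening inputs and outputs to vectors, both layers define the same function for all values of the parameters.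
   Context: For $n\in\mathbb{N}$ let $[n]=\{1,\dots,n\}$. Activation functions are applied entrywise. Rule based layer. Let $\Theta=\{w_1,\dots,w_N,b_1,\dots,b_M\}$ be a set of real learnable parameters. A rule $\mathbf{R}$ assigns to each input sample $x\in\mathbb{R}^n$ two rule functions $\mathbf{R}_W(x):[m]\times[n]\to\{0\}\cup[N]$ and $\mathbf{R}_b(x):[m]\to\{0\}\cup[M]$. The rule based layer is $f(x,\Theta,\mathbf{R})=\sigma(W_{\mathbf{R}_W(x)}\cdot x+b_{\mathbf{R}_b(x)})$, where $W_{\mathbf{R}_W(x)}\in\mathbb{R}^{m\times n}$ has $(i,j)$ entry $0$ if $\mathbf{R}_W(x)(i,j)=0$ and $w_{\mathbf{R}_W(x)(i,j)}$ otherwise, and $b_{\mathbf{R}_b(x)}\in\mathbb{R}^m$ has $k$-th entry $0$ if $\mathbf{R}_b(x)(k)=0$ and $b_{\mathbf{R}_b(x)(k)}$ otherwise. The case without bias corresponds to $\mathbf{R}_b\equiv 0$ and $M=0$. The rule $\mathbf{R}$, and the layer based on it, is called static if $\mathbf{R}_W(x)$ and $\mathbf{R}_b(x)$ do not depend on $x$. Convolutional layer. A convolutional layer architecture is given by a dimension $d\ge 1$, spatial input sizes $n_1,\dots,n_d$, numbers of input channels $C_{\mathrm{in}}$ and output channels $C_{\mathrm{out}}$, kernel sizes $k_1,\dots,k_d$, strides $s_1,\dots,s_d\ge 1$ and amounts of zero padding $p_1,\dots,p_d\ge 0$, with $k_a\le n_a+2p_a$ for all $a$, and with or without bias. Its parameters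 are the kernel weights $K_{c',c,u}$ with $c'\in[C_{\mathrm{out}}]$, $c\in[C_{\mathrm{in}}]$, $u\in\prod_{a}\{0,\dots,k_a-1\}$, and, if there is a bias, one bias $\beta_{c'}$ per output channel. It maps an input $X=(X_{c,v})$, $v\in\prod_a\{0,\dots,n_a-1\}$, to the output whose entry at channel $c'$ and position $v'\in\prod_a\{0,\dots,\lfloor (n_a+2p_a-k_a)/s_a\rfloor\}$ is $\sigma\big(\beta_{c'}+\sum_{c}\sum_{u}K_{c',c,u}\,X_{c,(s_av'_a+u_a-p_a)_a}\big)$, where entries of $X$ at positions outside $\prod_a\{0,\dots,n_a-1\}$ are read as $0$ (and $\beta_{c'}=0$ if there is no bias). *)

theory Defs
  imports "Jordan_Normal_Form.Matrix" "HOL-Library.FuncSet"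
begin

text \<open>
  Entry positions in \<open>real vec\<close> and \<open>real mat\<close> are zero-based, so \<open>{..<m}\<close> plays the role of \<open>[m]\<close>
  for positions. Parameter labels are one-based: the label \<open>0\<close> in the value of a rule means
  ``no parameter''.
\<close>

record rule =
  rule_W :: "real vec \<Rightarrow> nat \<times> nat \<Rightarrow> nat"
  rule_b :: "real vec \<Rightarrow> nat \<Rightarrow> nat"

definition is_rule :: "nat \<Rightarrow> nat \<Rightarrow> nat \<Rightarrow> nat \<Rightarrow> rule \<Rightarrow> bool" where
  "is_rule n m N M R \<longleftrightarrow>
     (\<forall>x \<in> carrier_vec n.
        rule_W R x \<in> {..<m} \<times> {..<n} \<rightarrow> {0..N} \<and> rule_b R x \<in> {..<m} \<rightarrow> {0..M})"

definition static_rule :: "nat \<Rightarrow> nat \<Rightarrow> rule \<Rightarrow> bool" where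
  "static_rule n m R \<longleftrightarrow>
     (\<forall>x \<in> carrier_vec n. \<forall>y \<in> carrier_vec n.
        (\<forall>p \<in> {..<m} \<times> {..<n}. rule_W R x p = rule_W R y p) \<and>
        (\<forall>k \<in> {..<m}. rule_b R x k = rule_b R y k))"

definition rule_without_bias :: "nat \<Rightarrow> nat \<Rightarrow> nat \<Rightarrow> rule \<Rightarrow> bool" where
  "rule_without_bias n m M R \<longleftrightarrow>
     M = 0 \<and> (\<forall>x \<in> carrier_vec n. \<forall>k \<in> {..<m}. rule_b R x k = 0)"

text \<open>
  The learnable parameters are represented by their names: \<open>Inl l\<close> stands for $w_l$ and \<open>Inr l\<close> for
  $b_l$. An assignment of values is a function on names.
\<close>

definition params :: "nat \<Rightarrow> nat \<Rightarrow> (nat + nat) set" where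
  "params N M = {1..N} <+> {1..M}"

definition rule_matrix :: "nat \<Rightarrow> nat \<Rightarrow> (nat + nat \<Rightarrow> real) \<Rightarrow> rule \<Rightarrow> real vec \<Rightarrow> real mat" where
  "rule_matrix n m \<theta> R x =
     mat m n (\<lambda>p. if rule_W R x p = 0 then 0 else \<theta> (Inl (rule_W R x p)))"

definition rule_bias :: "nat \<Rightarrow> (nat + nat \<Rightarrow> real) \<Rightarrow> rule \<Rightarrow> real vec \<Rightarrow> real vec" where
  "rule_bias m \<theta> R x = vec m (\<lambda>k. if rule_b R x k = 0 then 0 else \<theta> (Inr (rule_b R x k)))"

definition rule_based_layer ::
  "(real \<Rightarrow> real) \<Rightarrow> nat \<Rightarrow> nat \<Rightarrow> (nat + nat \<Rightarrow> real) \<Rightarrow> rule \<Rightarrow> real vec \<Rightarrow> real vec" where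
  "rule_based_layer \<sigma> n m \<theta> R x = map_vec \<sigma> (rule_matrix n m \<theta> R x *\<^sub>v x + rule_bias m \<theta> R x)"

definition fully_connected_layer ::
  "(real \<Rightarrow> real) \<Rightarrow> real mat \<Rightarrow> real vec \<Rightarrow> real vec \<Rightarrow> real vec" where
  "fully_connected_layer \<sigma> W b x = map_vec \<sigma> (W *\<^sub>v x + b)"

definition fully_connected_layer_without_bias ::
  "(real \<Rightarrow> real) \<Rightarrow> real mat \<Rightarrow> real vec \<Rightarrow> real vec" where
  "fully_connected_layer_without_bias \<sigma> W x = map_vec \<sigma> (W *\<^sub>v x)"

text \<open>
  The spatial directions are \<open>{1..conv_dim A}\<close>; sizes, strides and paddings are only relevant there.
  Spatial positions are integer-valued so that positions in the padding, which may have negative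
  coordinates, can be written down.
\<close>

record conv_arch =
  conv_dim :: nat
  in_size :: "nat \<Rightarrow> nat"
  in_channels :: nat
  out_channels :: nat
  kernel_size :: "nat \<Rightarrow> nat"
  stride :: "nat \<Rightarrow> nat"
  padding :: "nat \<Rightarrow> nat"
  has_bias :: bool

definition valid_conv_arch :: "conv_arch \<Rightarrow> bool" where
  "valid_conv_arch A \<longleftrightarrow> conv_dim A \<ge> 1 \<and>
     (\<forall>a \<in> {1..conv_dim A}. stride A a \<ge> 1 \<and> kernel_size A a \<le> in_size A a + 2 * padding A a)"

definition out_size :: "conv_arch \<Rightarrow> nat \<Rightarrow> nat" where
  "out_size A a = (in_size A a + 2 * padding A a - kernel_size A a) div stride A a + 1"

definition grid :: "nat \<Rightarrow> (nat \<Rightarrow> nat) \<Rightarrow> (nat \<Rightarrow> int) set" where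
  "grid d s = (\<Pi>\<^sub>E a \<in> {1..d}. {0..<int (s a)})"

definition conv_in_index :: "conv_arch \<Rightarrow> (nat \<times> (nat \<Rightarrow> int)) set" where
  "conv_in_index A = {1..in_channels A} \<times> grid (conv_dim A) (in_size A)"

definition conv_out_index :: "conv_arch \<Rightarrow> (nat \<times> (nat \<Rightarrow> int)) set" where
  "conv_out_index A = {1..out_channels A} \<times> grid (conv_dim A) (out_size A)"

definition kernel_index :: "conv_arch \<Rightarrow> (nat \<times> nat \<times> (nat \<Rightarrow> int)) set" where
  "kernel_index A =
     {1..out_channels A} \<times> {1..in_channels A} \<times> grid (conv_dim A) (kernel_size A)"

definition bias_index :: "conv_arch \<Rightarrow> nat set" where
  "bias_index A = (if has_bias A then {1..out_channels A} else {})"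

definition zero_padded ::
  "conv_arch \<Rightarrow> (nat \<times> (nat \<Rightarrow> int) \<Rightarrow> real) \<Rightarrow> nat \<times> (nat \<Rightarrow> int) \<Rightarrow> real" where
  "zero_padded A X i = (if i \<in> conv_in_index A then X i else 0)"

definition conv_layer ::
  "(real \<Rightarrow> real) \<Rightarrow> conv_arch \<Rightarrow> (nat \<times> nat \<times> (nat \<Rightarrow> int) \<Rightarrow> real) \<Rightarrow> (nat \<Rightarrow> real) \<Rightarrow>
   (nat \<times> (nat \<Rightarrow> int) \<Rightarrow> real) \<Rightarrow> nat \<times> (nat \<Rightarrow> int) \<Rightarrow> real" where
  "conv_layer \<sigma> A K \<beta> X = (\<lambda>(c', v').
     \<sigma> ((if has_bias A then \<beta> c' else 0) +
        (\<Sum>c \<in> {1..in_channels A}. \<Sum>u \<in> grid (conv_dim A) (kernel_size A).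
           K (c', c, u) *
           zero_padded A X
             (c, \<lambda>a \<in> {1..conv_dim A}. int (stride A a) * v' a + u a - int (padding A a)))))"

definition conv_in_dim :: "conv_arch \<Rightarrow> nat" where
  "conv_in_dim A = in_channels A * (\<Prod>a \<in> {1..conv_dim A}. in_size A a)"

definition conv_out_dim :: "conv_arch \<Rightarrow> nat" where
  "conv_out_dim A = out_channels A * (\<Prod>a \<in> {1..conv_dim A}. out_size A a)"

text \<open>
  A flattening order is any enumeration \<open>e\<close> of the index set \<open>I\<close> by vector positions (row-major,
  channel-last, ...).
\<close>

definition flattening_order :: "('i \<Rightarrow> nat) \<Rightarrow> 'i set \<Rightarrow> nat \<Rightarrow> bool" where
  "flattening_order e I D \<longleftrightarrow> bij_betw e I {..<D}"

definition flatten :: "('i \<Rightarrow> nat) \<Rightarrow> 'i set \<Rightarrow> nat \<Rightarrow> ('i \<Rightarrow> real) \<Rightarrow> real vec" where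
  "flatten e I D X = vec D (\<lambda>j. X (the_inv_into I e j))"

lemma finite_grid: "finite (grid d s)"
  by (simp add: grid_def finite_PiE)

lemma card_grid: "card (grid d s) = (\<Prod>a \<in> {1..d}. s a)"
  by (simp add: grid_def card_PiE)

lemma flattening_order_in_exists: "\<exists>e. flattening_order e (conv_in_index A) (conv_in_dim A)"
  using ex_bij_betw_finite_nat[of "conv_in_index A"]
  by (simp add: flattening_order_def conv_in_index_def conv_in_dim_def finite_grid
      card_cartesian_product card_grid lessThan_atLeast0)

lemma flattening_order_out_exists: "\<exists>e. flattening_order e (conv_out_index A) (conv_out_dim A)"
  using ex_bij_betw_finite_nat[of "conv_out_index A"]
  by (simp add: flattening_order_def conv_out_index_def conv_out_dim_def finite_grid
      card_cartesian_product card_grid lessThan_atLeast0)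

end

theory Submission imports Defs begin

text \<open>
  Each entry of the matrix of a fully connected or a convolutional layer is either zero or equal to
  one parameter of the layer, and which of these applies does not depend on the input; the same
  holds for the bias vector. Numbering the parameters turns this pattern into a static rule. For
  convolutions, the entry in row \<open>(c', v')\<close> and column \<open>(c, v)\<close> is the kernel weight \<open>K (c', c, u)\<close>
  with \<open>u = v + p - s v'\<close>, or zero if this \<open>u\<close> lies outside the kernel.
\<close>

section \<open>Parameter sharing patterns as static rules\<close>

text \<open>Only the choice of \<open>wt\<close> and \<open>bs\<close> distinguishes the kinds of
  layers. \<open>None\<close> marks an entry fixed at zero, and positions with the same
  \<open>Some q\<close> share the parameter \<open>q\<close>. The rule and \<open>\<phi>\<close>
  come before \<open>\<sigma>\<close> and \<open>\<theta>\<close>, so one numbering serves all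
  parameter values.\<close>

lemma static_rule_of_sharing_pattern:
  fixes wt :: "nat \<times> nat \<Rightarrow> 'p option" and bs :: "nat \<Rightarrow> 'q option"
  assumes "finite P" and "finite Q"
    and wt: "\<And>p q. p \<in> {..<m} \<times> {..<n} \<Longrightarrow> wt p = Some q \<Longrightarrow> q \<in> P"
    and bs: "\<And>k q. k < m \<Longrightarrow> bs k = Some q \<Longrightarrow> q \<in> Q"
  obtains N M R \<phi> where "is_rule n m N M R" and "static_rule n m R"
    and "Q = {} \<Longrightarrow> rule_without_bias n m M R"
    and "bij_betw \<phi> (P <+> Q) (params N M)"
    and "\<And>\<sigma> \<theta> x. x \<in> carrier_vec n \<Longrightarrow>
      rule_based_layer \<sigma> n m \<theta> R x =
      vec m (\<lambda>i. \<sigma> ((\<Sum>j<n. (case wt (i, j) of None \<Rightarrow> 0 | Some q \<Rightarrow> \<theta> (\<phi> (Inl q))) * x $ j)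
        + (case bs i of None \<Rightarrow> 0 | Some q \<Rightarrow> \<theta> (\<phi> (Inr q)))))"
proof -
  \<comment> \<open>Numbering starts at 1 because label 0 means that there is no parameter; the
    witnesses are \<open>N = card P\<close> and \<open>M = card Q\<close>.\<close>
  obtain f where f: "bij_betw f P {1..card P}"
    using ex_bij_betw_nat_finite_1[OF \<open>finite P\<close>] bij_betw_inv by blast
  obtain g where g: "bij_betw g Q {1..card Q}"
    using ex_bij_betw_nat_finite_1[OF \<open>finite Q\<close>] bij_betw_inv by blast
  have f_range: "f q \<in> {1..card P}" if "q \<in> P" for q
    using f that by (rule bij_betw_apply)
  have g_range: "g q \<in> {1..card Q}" if "q \<in> Q" for q
    using g that by (rule bij_betw_apply)
  \<comment> \<open>Both rule functions discard the input, which makes the rule static by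
    construction.\<close>
  define R where "R = \<lparr>rule_W = \<lambda>_ p. case wt p of None \<Rightarrow> 0 | Some q \<Rightarrow> f q,
    rule_b = \<lambda>_ k. case bs k of None \<Rightarrow> 0 | Some q \<Rightarrow> g q\<rparr>"
  show ?thesis
  proof
    show "is_rule n m (card P) (card Q) R"
      using wt bs f_range g_range
      by (fastforce simp: is_rule_def R_def split: option.split)
    show "static_rule n m R"
      by (simp add: static_rule_def R_def)
    show "rule_without_bias n m (card Q) R" if "Q = {}"
      using bs that by (auto simp: rule_without_bias_def R_def split: option.split)
    \<comment> \<open>Weights and biases are numbered separately, matching the constructors
      \<open>Inl\<close> and \<open>Inr\<close> in \<open>params\<close>.\<close>
    show "bij_betw (map_sum f g) (P <+> Q) (params (card P) (card Q))"
    proof (rule bij_betw_imageI)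
      show "inj_on (map_sum f g) (P <+> Q)"
      proof (rule inj_onI)
        fix p q assume "p \<in> P <+> Q" and "q \<in> P <+> Q" and "map_sum f g p = map_sum f g q"
        then show "p = q"
          using f g by (cases p; cases q) (auto simp: bij_betw_def dest: inj_onD)
      qed
      have "map_sum f g ` (P <+> Q) = f ` P <+> g ` Q"
        by (simp add: Plus_def image_Un image_image)
      then show "map_sum f g ` (P <+> Q) = params (card P) (card Q)"
        using f g by (simp add: params_def bij_betw_def)
    qed
    show "rule_based_layer \<sigma> n m \<theta> R x =
      vec m (\<lambda>i. \<sigma> ((\<Sum>j<n. (case wt (i, j) of None \<Rightarrow> 0
          | Some q \<Rightarrow> \<theta> (map_sum f g (Inl q))) * x $ j)
        + (case bs i of None \<Rightarrow> 0 | Some q \<Rightarrow> \<theta> (map_sum f g (Inr q)))))"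
      if x: "x \<in> carrier_vec n" for \<sigma> \<theta> x
    proof (rule eq_vecI)
      fix i assume "i < dim_vec (vec m (\<lambda>i. \<sigma> ((\<Sum>j<n. (case wt (i, j) of None \<Rightarrow> 0
          | Some q \<Rightarrow> \<theta> (map_sum f g (Inl q))) * x $ j)
        + (case bs i of None \<Rightarrow> 0 | Some q \<Rightarrow> \<theta> (map_sum f g (Inr q))))))"
      then have i: "i < m" by simp
      \<comment> \<open>A parameter label is at least 1, so the test for label 0 detects exactly the
        \<open>None\<close> entries.\<close>
      have W: "(if rule_W R x (i, j) = 0 then 0 else \<theta> (Inl (rule_W R x (i, j)))) =
          (case wt (i, j) of None \<Rightarrow> 0 | Some q \<Rightarrow> \<theta> (map_sum f g (Inl q)))" if "j < n" for j
        using wt[of "(i, j)"] i that f_range by (cases "wt (i, j)") (force simp: R_def)+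
      have b: "(if rule_b R x i = 0 then 0 else \<theta> (Inr (rule_b R x i))) =
          (case bs i of None \<Rightarrow> 0 | Some q \<Rightarrow> \<theta> (map_sum f g (Inr q)))"
        using bs[of i] i g_range by (cases "bs i") (force simp: R_def)+
      have "rule_based_layer \<sigma> n m \<theta> R x $ i =
          \<sigma> ((\<Sum>j<n. (if rule_W R x (i, j) = 0 then 0 else \<theta> (Inl (rule_W R x (i, j)))) * x $ j)
            + (if rule_b R x i = 0 then 0 else \<theta> (Inr (rule_b R x i))))"
        using i x
        by (simp add: rule_based_layer_def rule_matrix_def rule_bias_def scalar_prod_def
            lessThan_atLeast0)
      then show "rule_based_layer \<sigma> n m \<theta> R x $ i = vec m (\<lambda>i. \<sigma> ((\<Sum>j<n. (case wt (i, j) of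
          None \<Rightarrow> 0 | Some q \<Rightarrow> \<theta> (map_sum f g (Inl q))) * x $ j)
        + (case bs i of None \<Rightarrow> 0 | Some q \<Rightarrow> \<theta> (map_sum f g (Inr q))))) $ i"
        using i by (simp add: W b cong: sum.cong_simp)
    qed (simp add: rule_based_layer_def rule_matrix_def rule_bias_def)
  qed
qed

section \<open>Fully connected layers\<close>

lemma fully_connected_layer_eq:
  assumes "W \<in> carrier_mat m n" and "b \<in> carrier_vec m" and "x \<in> carrier_vec n"
  shows "fully_connected_layer \<sigma> W b x = vec m (\<lambda>i. \<sigma> ((\<Sum>j<n. W $$ (i, j) * x $ j) + b $ i))"
  using assms
  by (intro eq_vecI) (auto simp: fully_connected_layer_def scalar_prod_def lessThan_atLeast0)

lemma fully_connected_layer_without_bias_eq: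
  assumes "W \<in> carrier_mat m n" and "x \<in> carrier_vec n"
  shows "fully_connected_layer_without_bias \<sigma> W x = vec m (\<lambda>i. \<sigma> (\<Sum>j<n. W $$ (i, j) * x $ j))"
  using assms
  by (intro eq_vecI)
    (auto simp: fully_connected_layer_without_bias_def scalar_prod_def lessThan_atLeast0)

text \<open>Nothing is shared and nothing is fixed at zero: with \<open>Some\<close> as both
  patterns every entry is its own parameter.\<close>

lemma fully_connected_is_static_rule_based:
  obtains N M R \<phi> where "is_rule n m N M R" and "static_rule n m R"
    and "bij_betw \<phi> (({..<m} \<times> {..<n}) <+> {..<m}) (params N M)"
    and "\<And>\<sigma> W b \<theta> x. \<lbrakk>W \<in> carrier_mat m n; b \<in> carrier_vec m;
      \<And>i j. \<lbrakk>i < m; j < n\<rbrakk> \<Longrightarrow> \<theta> (\<phi> (Inl (i, j))) = W $$ (i, j);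
      \<And>k. k < m \<Longrightarrow> \<theta> (\<phi> (Inr k)) = b $ k; x \<in> carrier_vec n\<rbrakk> \<Longrightarrow>
      rule_based_layer \<sigma> n m \<theta> R x = fully_connected_layer \<sigma> W b x"
proof (rule static_rule_of_sharing_pattern[where P = "{..<m} \<times> {..<n}" and Q = "{..<m}"
      and m = m and n = n and wt = Some and bs = Some])
  fix N M R \<phi>
  assume "is_rule n m N M R" and "static_rule n m R"
    and "bij_betw \<phi> (({..<m} \<times> {..<n}) <+> {..<m}) (params N M)"
    and layer: "\<And>\<sigma> \<theta> x. x \<in> carrier_vec n \<Longrightarrow> rule_based_layer \<sigma> n m \<theta> R x =
      vec m (\<lambda>i. \<sigma> ((\<Sum>j<n. (case Some (i, j) of None \<Rightarrow> 0 | Some q \<Rightarrow> \<theta> (\<phi> (Inl q))) * x $ j)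
        + (case Some i of None \<Rightarrow> 0 | Some q \<Rightarrow> \<theta> (\<phi> (Inr q)))))"
  then show thesis
    by (intro that) (auto simp: layer fully_connected_layer_eq)
qed auto

text \<open>With an empty set of bias parameters, the general construction returns a rule without
  bias.\<close>

lemma fully_connected_without_bias_is_static_rule_based:
  obtains N M R \<phi> where "is_rule n m N M R" and "static_rule n m R" and "rule_without_bias n m M R"
    and "bij_betw \<phi> ({..<m} \<times> {..<n}) (params N M)"
    and "\<And>\<sigma> W \<theta> x. \<lbrakk>W \<in> carrier_mat m n;
      \<And>i j. \<lbrakk>i < m; j < n\<rbrakk> \<Longrightarrow> \<theta> (\<phi> (i, j)) = W $$ (i, j); x \<in> carrier_vec n\<rbrakk> \<Longrightarrow>
      rule_based_layer \<sigma> n m \<theta> R x = fully_connected_layer_without_bias \<sigma> W x"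
proof (rule static_rule_of_sharing_pattern[where P = "{..<m} \<times> {..<n}" and Q = "{} :: nat set"
      and m = m and n = n and wt = Some and bs = "\<lambda>_. None"])
  fix N M R and \<phi> :: "(nat \<times> nat) + nat \<Rightarrow> nat + nat"
  assume R: "is_rule n m N M R" "static_rule n m R"
    and no_bias: "{} = ({} :: nat set) \<Longrightarrow> rule_without_bias n m M R"
    and \<phi>: "bij_betw \<phi> (({..<m} \<times> {..<n}) <+> {}) (params N M)"
    and layer: "\<And>\<sigma> \<theta> x. x \<in> carrier_vec n \<Longrightarrow> rule_based_layer \<sigma> n m \<theta> R x =
      vec m (\<lambda>i. \<sigma> ((\<Sum>j<n. (case Some (i, j) of None \<Rightarrow> 0 | Some q \<Rightarrow> \<theta> (\<phi> (Inl q))) * x $ j)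
        + (case None of None \<Rightarrow> 0 | Some q \<Rightarrow> \<theta> (\<phi> (Inr q)))))"
  \<comment> \<open>The numbering obtained lives on a disjoint sum with empty right summand;
    composing with \<open>Inl\<close> moves it to the matrix positions.\<close>
  have "bij_betw Inl ({..<m} \<times> {..<n}) (({..<m} \<times> {..<n}) <+> ({} :: nat set))"
    by (auto simp: bij_betw_def)
  then have "bij_betw (\<phi> \<circ> Inl) ({..<m} \<times> {..<n}) (params N M)"
    using \<phi> by (rule bij_betw_trans)
  with R no_bias show thesis
    by (intro that) (auto simp: layer fully_connected_layer_without_bias_eq)
qed auto

section \<open>Convolution as a sum over input positions\<close>

text \<open>Both sums run over the pairs that \<open>f\<close> and \<open>g\<close> match with each
  other, and all other terms vanish. The maps are inverse to each other on these pairs only, since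
  either may leave the other set.\<close>

lemma sum_reindex_partial:
  assumes "finite A" and "finite B"
    and "\<And>a. a \<in> A \<Longrightarrow> f a \<in> B \<Longrightarrow> g (f a) = a"
    and "\<And>b. b \<in> B \<Longrightarrow> g b \<in> A \<Longrightarrow> f (g b) = b"
  shows "(\<Sum>a\<in>A. if f a \<in> B then h a (f a) else 0) = (\<Sum>b\<in>B. if g b \<in> A then h (g b) b else 0)"
proof -
  have "(\<Sum>a\<in>A. if f a \<in> B then h a (f a) else 0) = (\<Sum>a \<in> {a \<in> A. f a \<in> B}. h a (f a))"
    using \<open>finite A\<close> by (rule sum.inter_filter[symmetric])
  also have "\<dots> = (\<Sum>b \<in> {b \<in> B. g b \<in> A}. h (g b) b)"
    by (rule sum.reindex_bij_witness[where i = g and j = f]) (use assms in auto)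
  also have "\<dots> = (\<Sum>b\<in>B. if g b \<in> A then h (g b) b else 0)"
    using \<open>finite B\<close> by (rule sum.inter_filter)
  finally show ?thesis .
qed

text \<open>Names the index expression inside \<open>conv_layer\<close> so that it can be inverted;
  its value may lie in the padding.\<close>

definition input_position ::
  "conv_arch \<Rightarrow> (nat \<Rightarrow> int) \<Rightarrow> (nat \<Rightarrow> int) \<Rightarrow> nat \<Rightarrow> int" where
  "input_position A v' u =
     (\<lambda>a \<in> {1..conv_dim A}. int (stride A a) * v' a + u a - int (padding A a))"

text \<open>Solves the equation of \<open>input_position\<close> for the kernel offset, which may
  fall outside the kernel. The restriction makes it comparable with elements of \<open>grid\<close>,
  which are \<open>undefined\<close> off the spatial directions.\<close>

definition kernel_position ::
  "conv_arch \<Rightarrow> (nat \<Rightarrow> int) \<Rightarrow> (nat \<Rightarrow> int) \<Rightarrow> nat \<Rightarrow> int" where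
  "kernel_position A v' v =
     (\<lambda>a \<in> {1..conv_dim A}. v a + int (padding A a) - int (stride A a) * v' a)"

text \<open>For fixed \<open>v'\<close> the two maps are opposite integer translations in each
  direction; membership in a grid settles the values elsewhere.\<close>

lemma input_position_kernel_position:
  "v \<in> grid (conv_dim A) s \<Longrightarrow> input_position A v' (kernel_position A v' v) = v"
  by (rule ext) (auto simp: grid_def input_position_def kernel_position_def PiE_def extensional_def)

lemma kernel_position_input_position:
  "u \<in> grid (conv_dim A) s \<Longrightarrow> kernel_position A v' (input_position A v' u) = u"
  by (rule ext) (auto simp: grid_def input_position_def kernel_position_def PiE_def extensional_def)

text \<open>For a fixed output position, offsets and input positions determine each other. Offsets
  landing in the padding contribute zero on the left, and inputs that no kernel offset reaches get
  coefficient zero on the right. The right side has the shape of one row of a matrix-vector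
  product.\<close>

lemma conv_sum_eq_sum_over_input:
  "(\<Sum>c \<in> {1..in_channels A}. \<Sum>u \<in> grid (conv_dim A) (kernel_size A).
      K (c', c, u) * zero_padded A X (c, input_position A v' u)) =
   (\<Sum>(c, v) \<in> conv_in_index A.
      (if kernel_position A v' v \<in> grid (conv_dim A) (kernel_size A)
       then K (c', c, kernel_position A v' v) else 0) * X (c, v))"
proof -
  have "(\<Sum>u \<in> grid (conv_dim A) (kernel_size A).
        K (c', c, u) * zero_padded A X (c, input_position A v' u)) =
      (\<Sum>v \<in> grid (conv_dim A) (in_size A).
        (if kernel_position A v' v \<in> grid (conv_dim A) (kernel_size A)
         then K (c', c, kernel_position A v' v) else 0) * X (c, v))"
    if c: "c \<in> {1..in_channels A}" for c
  proof -
    \<comment> \<open>Zero padding becomes a condition on the offset, the form that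
      \<open>sum_reindex_partial\<close> expects.\<close>
    have "(\<Sum>u \<in> grid (conv_dim A) (kernel_size A).
          K (c', c, u) * zero_padded A X (c, input_position A v' u)) =
        (\<Sum>u \<in> grid (conv_dim A) (kernel_size A).
          if input_position A v' u \<in> grid (conv_dim A) (in_size A)
          then K (c', c, u) * X (c, input_position A v' u) else 0)"
      using c by (intro sum.cong) (auto simp: zero_padded_def conv_in_index_def)
    also have "\<dots> = (\<Sum>v \<in> grid (conv_dim A) (in_size A).
          if kernel_position A v' v \<in> grid (conv_dim A) (kernel_size A)
          then K (c', c, kernel_position A v' v) * X (c, v) else 0)"
      by (rule sum_reindex_partial[where h = "\<lambda>u v. K (c', c, u) * X (c, v)"])
        (simp_all add: finite_grid input_position_kernel_position kernel_position_input_position)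
    also have "\<dots> = (\<Sum>v \<in> grid (conv_dim A) (in_size A).
        (if kernel_position A v' v \<in> grid (conv_dim A) (kernel_size A)
         then K (c', c, kernel_position A v' v) else 0) * X (c, v))"
      by (intro sum.cong) auto
    finally show ?thesis .
  qed
  then show ?thesis
    by (simp add: conv_in_index_def sum.cartesian_product[symmetric])
qed

section \<open>Convolutional layers on flattened inputs and outputs\<close>

text \<open>The inverse of the enumeration is a bijection onto \<open>I\<close>, so a sum over
  vector positions can be reindexed whatever the order chosen.\<close>

lemma sum_flatten:
  assumes "flattening_order e I D"
  shows "(\<Sum>j<D. h (the_inv_into I e j) * flatten e I D X $ j) = (\<Sum>i\<in>I. h i * X i)"
proof -
  have "bij_betw (the_inv_into I e) {..<D} I"
    using assms unfolding flattening_order_def by (rule bij_betw_the_inv_into)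
  then have "(\<Sum>j<D. h (the_inv_into I e j) * X (the_inv_into I e j)) = (\<Sum>i\<in>I. h i * X i)"
    by (rule sum.reindex_bij_betw)
  then show ?thesis
    by (simp add: flatten_def)
qed

lemma convolution_is_static_rule_based:
  assumes ein: "flattening_order ein (conv_in_index A) (conv_in_dim A)"
    and eout: "flattening_order eout (conv_out_index A) (conv_out_dim A)"
  obtains N M R \<phi> where "is_rule (conv_in_dim A) (conv_out_dim A) N M R"
    and "static_rule (conv_in_dim A) (conv_out_dim A) R"
    and "\<not> has_bias A \<Longrightarrow> rule_without_bias (conv_in_dim A) (conv_out_dim A) M R"
    and "bij_betw \<phi> (kernel_index A <+> bias_index A) (params N M)"
    and "\<And>\<sigma> K \<beta> \<theta> X. \<lbrakk>\<And>q. q \<in> kernel_index A \<Longrightarrow> \<theta> (\<phi> (Inl q)) = K q;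
      \<And>c'. c' \<in> bias_index A \<Longrightarrow> \<theta> (\<phi> (Inr c')) = \<beta> c'\<rbrakk> \<Longrightarrow>
      rule_based_layer \<sigma> (conv_in_dim A) (conv_out_dim A) \<theta> R
          (flatten ein (conv_in_index A) (conv_in_dim A) X) =
        flatten eout (conv_out_index A) (conv_out_dim A) (conv_layer \<sigma> A K \<beta> X)"
proof -
  \<comment> \<open>\<open>ix\<close> reads a column number as an input index, \<open>ox\<close> a
    row number as an output index.\<close>
  define ix where "ix = the_inv_into (conv_in_index A) ein"
  define ox where "ox = the_inv_into (conv_out_index A) eout"
  have ix: "ix j \<in> conv_in_index A" if "j < conv_in_dim A" for j
    using bij_betw_the_inv_into[OF ein[unfolded flattening_order_def]] that
    unfolding ix_def by (auto dest: bij_betw_apply)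
  have ox: "ox i \<in> conv_out_index A" if "i < conv_out_dim A" for i
    using bij_betw_the_inv_into[OF eout[unfolded flattening_order_def]] that
    unfolding ox_def by (auto dest: bij_betw_apply)
  \<comment> \<open>The parameter depends on the two positions only through the offset
    \<open>kernel_position A v' v\<close>; this is the weight sharing of the convolution.\<close>
  define tap :: "nat \<times> (nat \<Rightarrow> int) \<Rightarrow> nat \<times> (nat \<Rightarrow> int) \<Rightarrow> (nat \<times> nat \<times> (nat \<Rightarrow> int)) option"
    where "tap = (\<lambda>(c', v') (c, v).
    if kernel_position A v' v \<in> grid (conv_dim A) (kernel_size A)
    then Some (c', c, kernel_position A v' v) else None)"
  define wt where "wt = (\<lambda>(i, j). tap (ox i) (ix j))"
  \<comment> \<open>\<open>fst\<close> drops the spatial position: all rows of one output channel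
    share a bias.\<close>
  define bs where "bs = (\<lambda>i. if has_bias A then Some (fst (ox i)) else None)"
  have tap: "q \<in> kernel_index A"
    if "o' \<in> conv_out_index A" "i' \<in> conv_in_index A" "tap o' i' = Some q" for o' i' q
    using that
    by (auto simp: tap_def conv_out_index_def conv_in_index_def kernel_index_def split: if_splits)
  have wt_mem: "q \<in> kernel_index A"
    if "p \<in> {..<conv_out_dim A} \<times> {..<conv_in_dim A}" "wt p = Some q" for p q
    using that by (auto simp: wt_def intro: tap[OF ox ix])
  have bs_mem: "q \<in> bias_index A" if "k < conv_out_dim A" "bs k = Some q" for k q
    using that ox[of k] by (auto simp: bs_def bias_index_def conv_out_index_def split: if_splits)
  have fin: "finite (kernel_index A)" "finite (bias_index A)"
    by (auto simp: kernel_index_def bias_index_def finite_grid)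
  show thesis
  proof (rule static_rule_of_sharing_pattern[OF fin wt_mem bs_mem])
    fix N M R \<phi>
    assume R: "is_rule (conv_in_dim A) (conv_out_dim A) N M R"
      "static_rule (conv_in_dim A) (conv_out_dim A) R"
      "bias_index A = {} \<Longrightarrow> rule_without_bias (conv_in_dim A) (conv_out_dim A) M R"
      "bij_betw \<phi> (kernel_index A <+> bias_index A) (params N M)"
    and layer: "\<And>\<sigma> \<theta> x. x \<in> carrier_vec (conv_in_dim A) \<Longrightarrow>
      rule_based_layer \<sigma> (conv_in_dim A) (conv_out_dim A) \<theta> R x =
      vec (conv_out_dim A) (\<lambda>i. \<sigma> ((\<Sum>j<conv_in_dim A.
          (case wt (i, j) of None \<Rightarrow> 0 | Some q \<Rightarrow> \<theta> (\<phi> (Inl q))) * x $ j)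
        + (case bs i of None \<Rightarrow> 0 | Some q \<Rightarrow> \<theta> (\<phi> (Inr q)))))"
    show thesis
    proof (rule that[OF R(1,2) _ R(4)])
      \<comment> \<open>\<open>bias_index A\<close> is then empty, which triggers the bias-free
        clause of the pattern lemma.\<close>
      show "rule_without_bias (conv_in_dim A) (conv_out_dim A) M R" if "\<not> has_bias A"
        using that R(3) by (simp add: bias_index_def)
    next
      fix \<sigma> :: "real \<Rightarrow> real" and K \<beta> X and \<theta> :: "nat + nat \<Rightarrow> real"
      assume K: "\<And>q. q \<in> kernel_index A \<Longrightarrow> \<theta> (\<phi> (Inl q)) = K q"
        and \<beta>: "\<And>c'. c' \<in> bias_index A \<Longrightarrow> \<theta> (\<phi> (Inr c')) = \<beta> c'"
      let ?x = "flatten ein (conv_in_index A) (conv_in_dim A) X"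
      have "\<sigma> ((\<Sum>j<conv_in_dim A.
            (case wt (i, j) of None \<Rightarrow> 0 | Some q \<Rightarrow> \<theta> (\<phi> (Inl q))) * ?x $ j)
          + (case bs i of None \<Rightarrow> 0 | Some q \<Rightarrow> \<theta> (\<phi> (Inr q)))) = conv_layer \<sigma> A K \<beta> X (ox i)"
        if i: "i < conv_out_dim A" for i
      proof -
        obtain c' v' where ox_i: "ox i = (c', v')" by fastforce
        have bias: "(case bs i of None \<Rightarrow> 0 | Some q \<Rightarrow> \<theta> (\<phi> (Inr q))) =
            (if has_bias A then \<beta> c' else 0)"
          using bs_mem[OF i] by (simp add: bs_def ox_i \<beta>)
        \<comment> \<open>The flattening is undone first, since \<open>tap\<close> and
          \<open>conv_layer\<close> speak of channels and positions.\<close>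
        have "(\<Sum>j<conv_in_dim A.
              (case wt (i, j) of None \<Rightarrow> 0 | Some q \<Rightarrow> \<theta> (\<phi> (Inl q))) * ?x $ j) =
            (\<Sum>k \<in> conv_in_index A. (case tap (ox i) k of None \<Rightarrow> 0 | Some q \<Rightarrow> \<theta> (\<phi> (Inl q))) * X k)"
          using sum_flatten[OF ein,
              of "\<lambda>k. case tap (ox i) k of None \<Rightarrow> 0 | Some q \<Rightarrow> \<theta> (\<phi> (Inl q))"]
          by (simp add: wt_def ix_def)
        \<comment> \<open>The values of \<open>\<theta>\<close> are prescribed on kernel weights in
          \<open>kernel_index A\<close>; the fact \<open>tap\<close> ensures that every weight used
          lies there.\<close>
        also have "\<dots> = (\<Sum>k \<in> conv_in_index A. (case tap (ox i) k of None \<Rightarrow> 0 | Some q \<Rightarrow> K q) * X k)"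
          using tap[OF ox[OF i]] K by (intro sum.cong refl) (auto split: option.split)
        also have "\<dots> = (\<Sum>(c, v) \<in> conv_in_index A.
            (if kernel_position A v' v \<in> grid (conv_dim A) (kernel_size A)
             then K (c', c, kernel_position A v' v) else 0) * X (c, v))"
          by (intro sum.cong) (auto simp: tap_def ox_i)
        also have "\<dots> = (\<Sum>c \<in> {1..in_channels A}. \<Sum>u \<in> grid (conv_dim A) (kernel_size A).
            K (c', c, u) * zero_padded A X (c, input_position A v' u))"
          by (rule conv_sum_eq_sum_over_input[symmetric])
        finally show ?thesis
          by (simp add: bias ox_i conv_layer_def input_position_def add.commute)
      qed
      then show "rule_based_layer \<sigma> (conv_in_dim A) (conv_out_dim A) \<theta> R ?x =
          flatten eout (conv_out_index A) (conv_out_dim A) (conv_layer \<sigma> A K \<beta> X)"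
        by (subst layer) (auto simp: flatten_def ox_def)
    qed
  qed
qed

section \<open>Fully connected and convolutional layers as static rule based layers\<close>

theorem theorem1:
  fixes \<sigma> :: "real \<Rightarrow> real"
  shows
    "(\<forall>n m :: nat. \<exists>N M R \<phi>.
        is_rule n m N M R \<and> static_rule n m R \<and>
        bij_betw \<phi> (({..<m} \<times> {..<n}) <+> {..<m}) (params N M) \<and>
        (\<forall>W \<in> carrier_mat m n. \<forall>b \<in> carrier_vec m. \<forall>\<theta>.
           (\<forall>i<m. \<forall>j<n. \<theta> (\<phi> (Inl (i, j))) = W $$ (i, j)) \<and>
           (\<forall>k<m. \<theta> (\<phi> (Inr k)) = b $ k) \<longrightarrow>
           (\<forall>x \<in> carrier_vec n.
              rule_based_layer \<sigma> n m \<theta> R x = fully_connected_layer \<sigma> W b x)))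
   \<and> (\<forall>n m :: nat. \<exists>N M R \<phi>.
        is_rule n m N M R \<and> static_rule n m R \<and> rule_without_bias n m M R \<and>
        bij_betw \<phi> ({..<m} \<times> {..<n}) (params N M) \<and>
        (\<forall>W \<in> carrier_mat m n. \<forall>\<theta>.
           (\<forall>i<m. \<forall>j<n. \<theta> (\<phi> (i, j)) = W $$ (i, j)) \<longrightarrow>
           (\<forall>x \<in> carrier_vec n.
              rule_based_layer \<sigma> n m \<theta> R x = fully_connected_layer_without_bias \<sigma> W x)))
   \<and> (\<forall>A ein eout.
        valid_conv_arch A \<and>
        flattening_order ein (conv_in_index A) (conv_in_dim A) \<and>
        flattening_order eout (conv_out_index A) (conv_out_dim A) \<longrightarrow>
        (\<exists>N M R \<phi>.
           is_rule (conv_in_dim A) (conv_out_dim A) N M R \<and>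
           static_rule (conv_in_dim A) (conv_out_dim A) R \<and>
           (\<not> has_bias A \<longrightarrow> rule_without_bias (conv_in_dim A) (conv_out_dim A) M R) \<and>
           bij_betw \<phi> (kernel_index A <+> bias_index A) (params N M) \<and>
           (\<forall>K \<beta> \<theta>.
              (\<forall>q \<in> kernel_index A. \<theta> (\<phi> (Inl q)) = K q) \<and>
              (\<forall>c' \<in> bias_index A. \<theta> (\<phi> (Inr c')) = \<beta> c') \<longrightarrow>
              (\<forall>X. rule_based_layer \<sigma> (conv_in_dim A) (conv_out_dim A) \<theta> R
                      (flatten ein (conv_in_index A) (conv_in_dim A) X)
                    = flatten eout (conv_out_index A) (conv_out_dim A)
                        (conv_layer \<sigma> A K \<beta> X)))))"
proof (intro conjI allI impI)
  fix n m :: nat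
  show "\<exists>N M R \<phi>.
        is_rule n m N M R \<and> static_rule n m R \<and>
        bij_betw \<phi> (({..<m} \<times> {..<n}) <+> {..<m}) (params N M) \<and>
        (\<forall>W \<in> carrier_mat m n. \<forall>b \<in> carrier_vec m. \<forall>\<theta>.
           (\<forall>i<m. \<forall>j<n. \<theta> (\<phi> (Inl (i, j))) = W $$ (i, j)) \<and>
           (\<forall>k<m. \<theta> (\<phi> (Inr k)) = b $ k) \<longrightarrow>
           (\<forall>x \<in> carrier_vec n.
              rule_based_layer \<sigma> n m \<theta> R x = fully_connected_layer \<sigma> W b x))"
    \<comment> \<open>Matching the conjuncts with the obtained facts fixes the witnesses;
      \<open>blast\<close> then passes from meta-level to object-level quantifiers.\<close>
    by (rule fully_connected_is_static_rule_based[of n m]) ((intro exI conjI; assumption?); blast)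
next
  fix n m :: nat
  show "\<exists>N M R \<phi>.
        is_rule n m N M R \<and> static_rule n m R \<and> rule_without_bias n m M R \<and>
        bij_betw \<phi> ({..<m} \<times> {..<n}) (params N M) \<and>
        (\<forall>W \<in> carrier_mat m n. \<forall>\<theta>.
           (\<forall>i<m. \<forall>j<n. \<theta> (\<phi> (i, j)) = W $$ (i, j)) \<longrightarrow>
           (\<forall>x \<in> carrier_vec n.
              rule_based_layer \<sigma> n m \<theta> R x = fully_connected_layer_without_bias \<sigma> W x))"
    by (rule fully_connected_without_bias_is_static_rule_based[of n m]) ((intro exI conjI; assumption?); blast)
next
  fix A ein eout
  assume "valid_conv_arch A \<and>
        flattening_order ein (conv_in_index A) (conv_in_dim A) \<and>
        flattening_order eout (conv_out_index A) (conv_out_dim A)"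
  then have ein: "flattening_order ein (conv_in_index A) (conv_in_dim A)"
    and eout: "flattening_order eout (conv_out_index A) (conv_out_dim A)"
    by auto
  show "\<exists>N M R \<phi>.
           is_rule (conv_in_dim A) (conv_out_dim A) N M R \<and>
           static_rule (conv_in_dim A) (conv_out_dim A) R \<and>
           (\<not> has_bias A \<longrightarrow> rule_without_bias (conv_in_dim A) (conv_out_dim A) M R) \<and>
           bij_betw \<phi> (kernel_index A <+> bias_index A) (params N M) \<and>
           (\<forall>K \<beta> \<theta>.
              (\<forall>q \<in> kernel_index A. \<theta> (\<phi> (Inl q)) = K q) \<and>
              (\<forall>c' \<in> bias_index A. \<theta> (\<phi> (Inr c')) = \<beta> c') \<longrightarrow>
              (\<forall>X. rule_based_layer \<sigma> (conv_in_dim A) (conv_out_dim A) \<theta> R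
                      (flatten ein (conv_in_index A) (conv_in_dim A) X)
                    = flatten eout (conv_out_index A) (conv_out_dim A)
                        (conv_layer \<sigma> A K \<beta> X)))"
    by (rule convolution_is_static_rule_based[OF ein eout]) ((intro exI conjI; assumption?); blast)
qed

end
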